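(* Let $H$ be a Hilbert space, let $A$ be the generator of a $C_0$-semigroup $(S(t))_{t\ge 0}$ on $H$ for which there are constants $M,\omega>0$ with $\|S(t)\|\le Me^{-\omega t}$ for all $t\ge 0$, and let $B:H\to H$ be a continuous linear operator. Let $\bar\tau>0$, let $\tau:[0,+\infty)\to(0,+\infty)$ be a continuous function with $0\le\tau(t)\le\bar\tau$ for all $t\ge 0$, and let $k\in L^1_{loc}([-\bar\tau,+\infty);\mathbb{R})$ satisfy, for some $K>0$, $\int_{t-\bar\tau}^t|k(s)|\,ds\le K$ for all $t\ge 0$. Let $G:H\to H$ satisfy $G(0)=0$ and, for some $L>0$, $\|G(U_1)-G(U_2)\|\le L\|U_1-U_2\|$ for all $U_1,U_2\in H$. Let $f:[-\bar\tau,0]\to H$ be a continuous function and put $U_0:=f(0)$. Then the problem $$U'(t)=AU(t)+k(t)BU(t-\tau(t))+G(U(t)),\quad t\in(0,\infty),\qquad U(t)=f(t),\quad t\in[-\bar\tau,0],$$ has a unique (weak) solution, given by Duhamel's formula $$U(t)=S(t)U_0+\int_0^tS(t-s)\big[G(U(s))+k(s)BU(s-\tau(s))\big]\,ds\qquad\text{for all } t\ge 0.$$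
   Context: A (weak) solution of the problem with initial datum $f$ is a continuous function $U:[-\bar\tau,+\infty)\to H$ with $U(t)=f(t)$ for all $t\in[-\bar\tau,0]$ that satisfies the Duhamel formula displayed in the claim for all $t\ge 0$. Thus the assertion is existence and uniqueness of such a continuous function $U$. *)

theory Defs
  imports "HOL-Analysis.Analysis"
begin

definition C0_semigroup :: "(real \<Rightarrow> 'a::real_normed_vector \<Rightarrow>\<^sub>L 'a) \<Rightarrow> bool" where
  "C0_semigroup S \<longleftrightarrow>
     S 0 = id_blinfun \<and>
     (\<forall>s\<ge>0. \<forall>t\<ge>0. S (s + t) = S s o\<^sub>L S t) \<and>
     (\<forall>x. ((\<lambda>t. blinfun_apply (S t) x) \<longlongrightarrow> x) (at_right 0))"

text \<open>An unbounded operator is given by its domain \<open>D\<close> together with a total function \<open>A\<close>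
  whose values outside \<open>D\<close> are irrelevant.\<close>

definition generator_of ::
    "(real \<Rightarrow> 'a::real_normed_vector \<Rightarrow>\<^sub>L 'a) \<Rightarrow> 'a set \<Rightarrow> ('a \<Rightarrow> 'a) \<Rightarrow> bool" where
  "generator_of S D A \<longleftrightarrow>
     D = {x. \<exists>y. ((\<lambda>h. (1 / h) *\<^sub>R (blinfun_apply (S h) x - x)) \<longlongrightarrow> y) (at_right 0)} \<and>
     (\<forall>x\<in>D. ((\<lambda>h. (1 / h) *\<^sub>R (blinfun_apply (S h) x - x)) \<longlongrightarrow> A x) (at_right 0))"

definition L1_loc :: "real set \<Rightarrow> (real \<Rightarrow> real) \<Rightarrow> bool" where
  "L1_loc I k \<longleftrightarrow> (\<forall>C. compact C \<and> C \<subseteq> I \<longrightarrow> k absolutely_integrable_on C)"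

text \<open>The vector-valued integral is the gauge integral, since the library's Bochner integral
  would force the space to be separable. For continuous \<open>U\<close> and locally integrable \<open>k\<close>
  the Duhamel integrand is Bochner integrable, and there both integrals agree. Integrability is
  demanded explicitly because \<^const>\<open>integral\<close> is \<open>0\<close> on non-integrable functions.
  The functions \<open>U\<close>, \<open>f\<close>, \<open>k\<close>, \<open>\<tau>\<close> are total, but only their values on \<open>[-\<tau>\<^sub>m, \<infinity>)\<close>, \<open>[-\<tau>\<^sub>m, 0]\<close>,
  \<open>[-\<tau>\<^sub>m, \<infinity>)\<close> and \<open>[0, \<infinity>)\<close>, respectively, matter.\<close>

definition weak_solution ::
    "(real \<Rightarrow> 'a::real_normed_vector \<Rightarrow>\<^sub>L 'a) \<Rightarrow> ('a \<Rightarrow>\<^sub>L 'a) \<Rightarrow> ('a \<Rightarrow> 'a) \<Rightarrow>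
     (real \<Rightarrow> real) \<Rightarrow> (real \<Rightarrow> real) \<Rightarrow> real \<Rightarrow> (real \<Rightarrow> 'a) \<Rightarrow> (real \<Rightarrow> 'a) \<Rightarrow> bool" where
  "weak_solution S B G k \<tau> \<tau>\<^sub>m f U \<longleftrightarrow>
     continuous_on {-\<tau>\<^sub>m..} U \<and>
     (\<forall>t\<in>{-\<tau>\<^sub>m..0}. U t = f t) \<and>
     (\<forall>t\<ge>0.
        (\<lambda>s. blinfun_apply (S (t - s)) (G (U s) + k s *\<^sub>R blinfun_apply B (U (s - \<tau> s))))
          integrable_on {0..t} \<and>
        U t = blinfun_apply (S t) (f 0) +
          integral {0..t}
            (\<lambda>s. blinfun_apply (S (t - s)) (G (U s) + k s *\<^sub>R blinfun_apply B (U (s - \<tau> s)))))"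

end

theory Submission
  imports Defs
begin

text \<open>The right-hand side of Duhamel's formula is a contraction on all of \<open>[0, \<infinity>)\<close> at once for the
  Bielecki norm \<open>sup \<parallel>U t\<parallel> / weight t\<close>, where \<open>weight t = exp (2 * \<integral>\<^sub>0\<^sup>t M (L + \<parallel>B\<parallel> \<bar>k\<bar>))\<close>; the delay
  does no harm because the weight is increasing. Banach's fixed point theorem for \<open>U / weight\<close> in
  the bounded continuous functions gives existence. A solution might a priori be unbounded in this
  norm, so uniqueness comes from the same estimate at the maximum of \<open>\<parallel>U - V\<parallel> / weight\<close> on a
  compact interval. The integrand is \<open>k\<close> times a continuous function with values in a possibly
  non-separable space; it is gauge integrable because it can be approximated, with error at most
  \<open>e * \<bar>k\<bar>\<close>, by \<open>k\<close> times a step function.\<close>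

section \<open>Gauge integrability of an integrable scalar function times a continuous vector
  function\<close>

text \<open>By the Cauchy criterion for gauge integrals: on a fine division the Riemann sums of
  \<open>f\<close> and \<open>g\<close> differ by at most \<open>e\<close> times a Riemann sum of
  \<open>h\<close>, and the latter sums stay bounded. The pointwise error may be unbounded, as
  \<open>h\<close> may be, so this goes beyond closure under uniform limits.\<close>

lemma integrable_dominated_approx:
  fixes f :: "real \<Rightarrow> 'a::banach" and h :: "real \<Rightarrow> real"
  assumes h: "h integrable_on {a..b}"
    and approx: "\<And>e. e > 0 \<Longrightarrow>
      \<exists>g. g integrable_on {a..b} \<and> (\<forall>x\<in>{a..b}. norm (f x - g x) \<le> e * h x)"
  shows "f integrable_on {a..b}"
proof -
  have h_nonneg: "h x \<ge> 0" if "x \<in> {a..b}" for x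
  proof -
    obtain g where "norm (f x - g x) \<le> 1 * h x"
      using approx[OF zero_less_one] \<open>x \<in> {a..b}\<close> by blast
    then have "norm (f x - g x) \<le> h x"
      by simp
    then show ?thesis
      using norm_ge_zero order_trans by blast
  qed
  \<comment> \<open>The added 1 makes \<open>c\<close> positive and an upper bound for the Riemann
    sums of \<open>h\<close> on \<open>\<gamma>2\<close>-fine divisions.\<close>
  define c where "c = integral {a..b} h + 1"
  have "integral {a..b} h \<ge> 0"
    using h h_nonneg by (rule integral_nonneg)
  then have "c > 0"
    by (simp add: c_def)
  have "\<exists>\<gamma>. gauge \<gamma> \<and> (\<forall>p1 p2. p1 tagged_division_of cbox a b \<and> \<gamma> fine p1 \<and>
      p2 tagged_division_of cbox a b \<and> \<gamma> fine p2 \<longrightarrow>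
      norm ((\<Sum>(x,K)\<in>p1. measure lborel K *\<^sub>R f x) - (\<Sum>(x,K)\<in>p2. measure lborel K *\<^sub>R f x)) < e)"
    if "e > 0" for e
  proof -
    \<comment> \<open>Error budget: \<open>e / 4\<close> for replacing \<open>f\<close> by
      \<open>g\<close> and \<open>e / 4\<close> for the distance from the Riemann sum of
      \<open>g\<close> to its integral keep every fine sum within \<open>e / 2\<close> of one
      vector, hence any two within \<open>e\<close>.\<close>
    have "e / (4 * c) > 0"
      using \<open>e > 0\<close> \<open>c > 0\<close> by simp
    then obtain g where g: "g integrable_on {a..b}"
      and fg: "\<And>x. x \<in> {a..b} \<Longrightarrow> norm (f x - g x) \<le> e / (4 * c) * h x"
      using approx by metis
    obtain \<gamma>1 where "gauge \<gamma>1" and \<gamma>1: "\<And>p. p tagged_division_of {a..b} \<Longrightarrow> \<gamma>1 fine p \<Longrightarrow>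
        norm ((\<Sum>(x,K)\<in>p. measure lborel K *\<^sub>R g x) - integral {a..b} g) < e / 4"
      using g[THEN integrable_integral] \<open>e > 0\<close> unfolding has_integral_real
      by (metis zero_less_divide_iff zero_less_numeral)
    obtain \<gamma>2 where "gauge \<gamma>2" and \<gamma>2: "\<And>p. p tagged_division_of {a..b} \<Longrightarrow> \<gamma>2 fine p \<Longrightarrow>
        norm ((\<Sum>(x,K)\<in>p. measure lborel K *\<^sub>R h x) - integral {a..b} h) < 1"
      using h[THEN integrable_integral] unfolding has_integral_real by (metis zero_less_one)
    have close: "norm ((\<Sum>(x,K)\<in>p. measure lborel K *\<^sub>R f x) - integral {a..b} g) < e / 2"
      if p: "p tagged_division_of {a..b}" and "\<gamma>1 fine p" "\<gamma>2 fine p" for p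
    proof -
      have "norm ((\<Sum>(x,K)\<in>p. measure lborel K *\<^sub>R f x) - (\<Sum>(x,K)\<in>p. measure lborel K *\<^sub>R g x))
          = norm (\<Sum>(x,K)\<in>p. measure lborel K *\<^sub>R (f x - g x))"
        by (simp add: sum_subtractf[symmetric] scaleR_diff_right case_prod_unfold)
      also have "\<dots> \<le> (\<Sum>(x,K)\<in>p. e / (4 * c) * (measure lborel K *\<^sub>R h x))"
      proof (rule sum_norm_le, clarify)
        fix x K
        assume "(x, K) \<in> p"
        then have "x \<in> {a..b}"
          using p tagged_division_ofD(2,3) by blast
        have "norm (measure lborel K *\<^sub>R (f x - g x)) \<le> measure lborel K * (e / (4 * c) * h x)"
          using mult_left_mono[OF fg[OF \<open>x \<in> {a..b}\<close>], of "measure lborel K"] by simp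
        then show "norm (measure lborel K *\<^sub>R (f x - g x)) \<le> e / (4 * c) * (measure lborel K *\<^sub>R h x)"
          by (simp add: mult_ac)
      qed
      also have "\<dots> = e / (4 * c) * (\<Sum>(x,K)\<in>p. measure lborel K *\<^sub>R h x)"
        by (simp add: sum_distrib_left case_prod_unfold)
      also have "\<dots> \<le> e / (4 * c) * c"
      proof (rule mult_left_mono)
        show "(\<Sum>(x,K)\<in>p. measure lborel K *\<^sub>R h x) \<le> c"
          using \<gamma>2[OF p \<open>\<gamma>2 fine p\<close>] by (simp add: c_def)
        show "0 \<le> e / (4 * c)"
          using \<open>e / (4 * c) > 0\<close> by simp
      qed
      also have "\<dots> = e / 4"
        using \<open>c > 0\<close> by simp
      finally have 1: "norm ((\<Sum>(x,K)\<in>p. measure lborel K *\<^sub>R f x) - (\<Sum>(x,K)\<in>p. measure lborel K *\<^sub>R g x))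
          \<le> e / 4" .
      show ?thesis
        using norm_triangle_lt[OF add_le_less_mono[OF 1 \<gamma>1[OF p \<open>\<gamma>1 fine p\<close>]]] by simp
    qed
    show ?thesis
    proof (intro exI[of _ "\<lambda>x. \<gamma>1 x \<inter> \<gamma>2 x"] conjI allI impI gauge_Int
        \<open>gauge \<gamma>1\<close> \<open>gauge \<gamma>2\<close>; elim conjE)
      fix p1 p2
      assume "p1 tagged_division_of cbox a b" "(\<lambda>x. \<gamma>1 x \<inter> \<gamma>2 x) fine p1"
        "p2 tagged_division_of cbox a b" "(\<lambda>x. \<gamma>1 x \<inter> \<gamma>2 x) fine p2"
      then show "norm ((\<Sum>(x,K)\<in>p1. measure lborel K *\<^sub>R f x) - (\<Sum>(x,K)\<in>p2. measure lborel K *\<^sub>R f x)) < e"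
        using norm_diff_triangle_less[OF close[of p1] close[of p2, unfolded norm_minus_commute]]
        by (simp add: fine_Int norm_minus_commute)
    qed
  qed
  then show ?thesis
    using integrable_Cauchy[of f a b] by simp
qed

text \<open>On a short interval \<open>g\<close> is nearly constant, and \<open>k\<close> times that
  constant is the required approximation. The bisection principle \<open>Bolzano\<close> glues these
  pieces over \<open>{a..b}\<close>.\<close>

lemma integrable_scaleR_continuous:
  fixes g :: "real \<Rightarrow> 'a::banach" and k :: "real \<Rightarrow> real"
  assumes k: "k integrable_on {a..b}" and abs_k: "(\<lambda>s. \<bar>k s\<bar>) integrable_on {a..b}"
    and g: "continuous_on {a..b} g"
  shows "(\<lambda>s. k s *\<^sub>R g s) integrable_on {a..b}"
proof (rule integrable_dominated_approx[OF abs_k])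
  fix e :: real
  assume "e > 0"
  \<comment> \<open>The local case of \<open>Bolzano\<close> has to serve all short intervals around
    \<open>x\<close>, including those that stick out of \<open>{a..b}\<close>; the inclusion premise
    makes these harmless.\<close>
  define P where "P u v \<longleftrightarrow> {u..v} \<subseteq> {a..b} \<longrightarrow>
    (\<exists>h. h integrable_on {u..v} \<and> (\<forall>x\<in>{u..v}. norm (k x *\<^sub>R g x - h x) \<le> e * \<bar>k x\<bar>))" for u v
  show "\<exists>h. h integrable_on {a..b} \<and> (\<forall>x\<in>{a..b}. norm (k x *\<^sub>R g x - h x) \<le> e * \<bar>k x\<bar>)"
  proof (cases "a \<le> b")
    case False
    then show ?thesis
      by (auto intro: exI[of _ "\<lambda>_. 0"])
  next
    case True
    then have "P a b"
    proof (induction rule: Bolzano)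
      case (trans u v w)
      show ?case
        unfolding P_def
      proof
        assume sub: "{u..w} \<subseteq> {a..b}"
        have "{u..v} \<subseteq> {a..b}" "{v..w} \<subseteq> {a..b}"
          using sub trans by auto
        then obtain h1 h2 where h1: "h1 integrable_on {u..v}"
          "\<And>x. x \<in> {u..v} \<Longrightarrow> norm (k x *\<^sub>R g x - h1 x) \<le> e * \<bar>k x\<bar>"
          and h2: "h2 integrable_on {v..w}"
          "\<And>x. x \<in> {v..w} \<Longrightarrow> norm (k x *\<^sub>R g x - h2 x) \<le> e * \<bar>k x\<bar>"
          using trans unfolding P_def by blast
        define h where "h x = (if x \<le> v then h1 x else h2 x)" for x
        have "h integrable_on {u..v}"
          using h1(1) by (rule integrable_eq) (simp add: h_def)
        \<comment> \<open>On \<open>{v..w}\<close> the glued function can differ from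
          \<open>h2\<close> only at the point \<open>v\<close>.\<close>
        moreover have "h integrable_on {v..w}"
          by (rule integrable_spike_finite[OF _ _ h2(1), of "{v}"]) (auto simp: h_def)
        ultimately have "h integrable_on {u..w}"
          by (rule Henstock_Kurzweil_Integration.integrable_combine[OF trans(3,4)])
        moreover have "\<forall>x\<in>{u..w}. norm (k x *\<^sub>R g x - h x) \<le> e * \<bar>k x\<bar>"
          using h1(2) h2(2) by (auto simp: h_def)
        ultimately show "\<exists>h. h integrable_on {u..w} \<and>
            (\<forall>x\<in>{u..w}. norm (k x *\<^sub>R g x - h x) \<le> e * \<bar>k x\<bar>)"
          by blast
      qed
    next
      case (local x)
      then obtain d where "d > 0"
        and d: "\<And>y. y \<in> {a..b} \<Longrightarrow> dist y x < d \<Longrightarrow> dist (g y) (g x) \<le> e"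
        using g \<open>e > 0\<close> unfolding continuous_on_iff by (meson atLeastAtMost_iff less_imp_le)
      have "P u v" if uv: "u \<le> x" "x \<le> v" "v - u < d" for u v
        unfolding P_def
      proof
        assume sub: "{u..v} \<subseteq> {a..b}"
        have "(\<lambda>s. k s *\<^sub>R g x) integrable_on {u..v}"
          using integrable_subinterval_real[OF k sub] by (rule integrable_on_scaleR_left)
        moreover have "norm (k y *\<^sub>R g y - k y *\<^sub>R g x) \<le> e * \<bar>k y\<bar>" if "y \<in> {u..v}" for y
        proof -
          have "dist y x < d"
            using that uv by (auto simp: dist_real_def)
          then have "norm (g y - g x) \<le> e"
            using d sub that by (auto simp: dist_norm)
          then show ?thesis
            using mult_left_mono[of _ e "\<bar>k y\<bar>"]
            by (simp add: scaleR_diff_right[symmetric] mult.commute[of e])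
        qed
        ultimately show "\<exists>h. h integrable_on {u..v} \<and>
            (\<forall>x\<in>{u..v}. norm (k x *\<^sub>R g x - h x) \<le> e * \<bar>k x\<bar>)"
          by blast
      qed
      then show ?case
        using \<open>d > 0\<close> by blast
    qed
    then show ?thesis
      by (simp add: P_def)
  qed
qed

section \<open>The integral estimate behind the exponential weight\<close>

text \<open>A substitute for the chain rule for \<open>exp (2 * a t)\<close>, where \<open>a\<close> is a primitive of the merely
  integrable \<open>m\<close>: on short intervals \<open>\<integral> m exp (2 a)\<close> is compared with the increment of \<open>exp (2 a)\<close>
  through \<open>exp x \<ge> 1 + x\<close>. Any constant greater than \<open>1/2\<close> in place of \<open>3/4\<close> would do.\<close>

lemma integral_mult_exp_primitive_le:
  fixes m a :: "real \<Rightarrow> real"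
  assumes m: "m integrable_on {0..T}" and m_nonneg: "\<And>s. s \<in> {0..T} \<Longrightarrow> m s \<ge> 0"
    and a: "\<And>t. t \<in> {0..T} \<Longrightarrow> a t = integral {0..t} m" and "0 \<le> T"
  shows "integral {0..T} (\<lambda>s. m s * exp (2 * a s)) \<le> 3 / 4 * exp (2 * a T)"
proof -
  have "continuous_on {0..T} (\<lambda>t. integral {0..t} m)"
    using m by (rule indefinite_integral_continuous_1)
  then have cont: "continuous_on {0..T} a"
    by (rule continuous_on_eq) (simp add: a)
  have abs_m: "(\<lambda>s. \<bar>m s\<bar>) integrable_on {0..T}"
    using m by (rule integrable_eq) (use m_nonneg in auto)
  have int: "(\<lambda>s. m s * exp (2 * a s)) integrable_on {0..T}"
    using integrable_scaleR_continuous[OF m abs_m, of "\<lambda>s. exp (2 * a s)"] cont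
    by (simp add: continuous_intros)
  have incr: "integral {u..v} m = a v - a u" if "0 \<le> u" "u \<le> v" "v \<le> T" for u v
    using Henstock_Kurzweil_Integration.integral_combine[of 0 u v m] integrable_subinterval_real[OF m, of 0 v] that by (simp add: a)
  have mono: "a u \<le> a v" if "0 \<le> u" "u \<le> v" "v \<le> T" for u v
    using incr[OF that] integral_nonneg[of m "{u..v}"] integrable_subinterval_real[OF m, of u v]
      m_nonneg that by auto
  \<comment> \<open>The bound is an increment of \<open>exp (2 * a)\<close>, so that the bounds of
    adjacent intervals add up under bisection; dropping the term at 0 then gives the claim.\<close>
  define P where "P u v \<longleftrightarrow> (0 \<le> u \<and> v \<le> T \<longrightarrow>
    integral {u..v} (\<lambda>s. m s * exp (2 * a s)) \<le> 3 / 4 * (exp (2 * a v) - exp (2 * a u)))" for u v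
  have "P 0 T"
    using \<open>0 \<le> T\<close>
  proof (induction rule: Bolzano)
    case (trans u v w)
    show ?case
      unfolding P_def
    proof
      assume uw: "0 \<le> u \<and> w \<le> T"
      have "integral {u..v} (\<lambda>s. m s * exp (2 * a s)) + integral {v..w} (\<lambda>s. m s * exp (2 * a s))
          = integral {u..w} (\<lambda>s. m s * exp (2 * a s))"
        using integrable_subinterval_real[OF int, of u w] uw trans
        by (intro Henstock_Kurzweil_Integration.integral_combine) auto
      then show "integral {u..w} (\<lambda>s. m s * exp (2 * a s))
          \<le> 3 / 4 * (exp (2 * a w) - exp (2 * a u))"
        using trans uw by (auto simp: P_def)
    qed
  next
    case (local x)
    \<comment> \<open>Keeping \<open>a u\<close> and \<open>a v\<close> within
      \<open>ln (3 / 2) / 4\<close> of \<open>a x\<close> lets \<open>2 * a\<close> grow by at most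
      \<open>ln (3 / 2)\<close> from \<open>u\<close> to \<open>v\<close>, and its exponential by at
      most the factor \<open>3 / 2\<close>.\<close>
    have "ln (3 / 2) / 4 > (0::real)"
      by simp
    then obtain d where "d > 0"
      and d: "\<And>y. y \<in> {0..T} \<Longrightarrow> dist y x < d \<Longrightarrow> dist (a y) (a x) < ln (3 / 2) / 4"
      using cont local unfolding continuous_on_iff by (meson atLeastAtMost_iff)
    have "P u v" if uv: "u \<le> x" "x \<le> v" "v - u < d" for u v
      unfolding P_def
    proof
      assume range: "0 \<le> u \<and> v \<le> T"
      have "dist (a u) (a x) < ln (3 / 2) / 4" "dist (a v) (a x) < ln (3 / 2) / 4"
        by (rule d; use uv range in \<open>auto simp: dist_real_def\<close>)+
      then have "2 * a v \<le> ln (3 / 2) + 2 * a u"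
        unfolding dist_real_def by linarith
      then have "exp (2 * a v) \<le> exp (ln (3 / 2) + 2 * a u)"
        by simp
      then have step: "exp (2 * a v) \<le> 3 / 2 * exp (2 * a u)"
        by (simp add: exp_add)
      have "integral {u..v} (\<lambda>s. m s * exp (2 * a s)) \<le> integral {u..v} (\<lambda>s. m s * exp (2 * a v))"
      proof (rule integral_le)
        show "(\<lambda>s. m s * exp (2 * a s)) integrable_on {u..v}"
          using integrable_subinterval_real[OF int] range by auto
        show "(\<lambda>s. m s * exp (2 * a v)) integrable_on {u..v}"
          using integrable_subinterval_real[OF m] range by (auto intro: integrable_on_mult_left)
        show "m s * exp (2 * a s) \<le> m s * exp (2 * a v)" if "s \<in> {u..v}" for s
          using mono[of s v] that range m_nonneg[of s] by (auto intro!: mult_left_mono)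
      qed
      also have "\<dots> = (a v - a u) * exp (2 * a v)"
        using incr[of u v] range uv by simp
      also have "\<dots> \<le> (a v - a u) * (3 / 2 * exp (2 * a u))"
        using step mono[of u v] range uv by (intro mult_left_mono) auto
      \<comment> \<open>\<open>3 / 2\<close> splits into \<open>3 / 4\<close> and the 2 that turns
        the increment of \<open>a\<close> into that of the exponent, ready for
        \<open>exp x \<ge> 1 + x\<close>.\<close>
      also have "\<dots> = 3 / 4 * (exp (2 * a u) * (2 * (a v - a u)))"
        by simp
      also have "\<dots> \<le> 3 / 4 * (exp (2 * a u) * (exp (2 * (a v - a u)) - 1))"
        by (intro mult_left_mono) (use exp_ge_add_one_self[of "2 * (a v - a u)"] in linarith, auto)
      also have "\<dots> = 3 / 4 * (exp (2 * a v) - exp (2 * a u))"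
        by (simp add: right_diff_distrib exp_add[symmetric])
      finally show "integral {u..v} (\<lambda>s. m s * exp (2 * a s))
          \<le> 3 / 4 * (exp (2 * a v) - exp (2 * a u))" .
    qed
    then show ?case
      using \<open>d > 0\<close> by blast
  qed
  then have "integral {0..T} (\<lambda>s. m s * exp (2 * a s)) \<le> 3 / 4 * (exp (2 * a T) - exp (2 * a 0))"
    by (simp add: P_def)
  also have "\<dots> \<le> 3 / 4 * exp (2 * a T)"
    by simp
  finally show ?thesis .
qed

section \<open>Continuity of orbits and convolutions of a bounded semigroup\<close>

lemma continuous_on_atLeastI:
  fixes h :: "real \<Rightarrow> 'a::metric_space"
  assumes "\<And>T. continuous_on {a..T} h"
  shows "continuous_on {a..} h"
  unfolding continuous_on_iff
proof (intro ballI allI impI)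
  fix x e :: real
  assume "x \<in> {a..}" "e > 0"
  then obtain d where "d > 0"
    and d: "\<And>y. y \<in> {a..x + 1} \<Longrightarrow> dist y x < d \<Longrightarrow> dist (h y) (h x) < e"
    using assms[of "x + 1", unfolded continuous_on_iff] by (metis atLeast_iff atLeastAtMost_iff
        less_add_one less_imp_le)
  have "dist (h y) (h x) < e" if "y \<in> {a..}" "dist y x < min d 1" for y
    by (rule d) (use that in \<open>auto simp: dist_real_def\<close>)
  then show "\<exists>d>0. \<forall>y\<in>{a..}. dist y x < d \<longrightarrow> dist (h y) (h x) < e"
    using \<open>d > 0\<close> by (intro exI[of _ "min d 1"]) auto
qed

locale bounded_semigroup =
  fixes S :: "real \<Rightarrow> 'a::banach \<Rightarrow>\<^sub>L 'a" and M :: real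
  assumes C0: "C0_semigroup S"
    and M_pos: "M > 0"
    and norm_S: "t \<ge> 0 \<Longrightarrow> norm (S t) \<le> M"
begin

lemma norm_S_apply: "t \<ge> 0 \<Longrightarrow> norm (S t x) \<le> M * norm x"
  using norm_blinfun[of "S t" x] norm_S[of t] by (meson mult_right_mono norm_ge_zero order_trans)

text \<open>Right-continuity at 0 is carried to other times by
  \<open>S v x - S u x = S u (S (v - u) x - x)\<close> for \<open>u < v\<close>, where
  \<open>S u\<close> is bounded by \<open>M\<close>. As the smaller time is factored out, this
  controls both sides of a given time.\<close>

lemma continuous_orbit: "continuous_on {0..} (\<lambda>t. S t x)"
  unfolding continuous_on_iff
proof (intro ballI allI impI)
  fix r e :: real
  assume "r \<in> {0..}" "e > 0"
  have "((\<lambda>t. S t x) \<longlongrightarrow> x) (at_right 0)"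
    using C0 by (simp add: C0_semigroup_def)
  then have "\<forall>\<^sub>F t in at_right 0. dist (S t x) x < e / M"
    using \<open>e > 0\<close> M_pos by (intro tendstoD) auto
  then obtain d where "d > 0" and d: "\<And>t. 0 < t \<Longrightarrow> t < d \<Longrightarrow> dist (S t x) x < e / M"
    by (auto simp: eventually_at_right_field)
  have close: "dist (S v x) (S u x) < e" if "0 \<le> u" "u < v" "v - u < d" for u v
  proof -
    have "S (u + (v - u)) = S u o\<^sub>L S (v - u)"
      using C0 that unfolding C0_semigroup_def by (meson diff_ge_0_iff_ge less_imp_le)
    then have "S v x - S u x = S u (S (v - u) x - x)"
      by (simp add: blinfun.diff_right)
    then have "norm (S v x - S u x) \<le> M * norm (S (v - u) x - x)"
      using norm_S_apply that by simp
    also have "\<dots> < M * (e / M)"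
      using d[of "v - u"] that M_pos by (intro mult_strict_left_mono) (auto simp: dist_norm)
    finally show ?thesis
      using M_pos by (simp add: dist_norm)
  qed
  have "dist (S y x) (S r x) < e" if "y \<in> {0..}" "dist y r < d" for y
    using close[of y r] close[of r y] that \<open>r \<in> {0..}\<close> \<open>e > 0\<close>
    by (cases y r rule: linorder_cases) (auto simp: dist_real_def dist_commute)
  then show "\<exists>d>0. \<forall>y\<in>{0..}. dist y r < d \<longrightarrow> dist (S y x) (S r x) < e"
    using \<open>d > 0\<close> by blast
qed

text \<open>The uniform bound \<open>M\<close> controls the change of the vector independently of
  the time, and orbit continuity controls the change of the time at the fixed vector
  \<open>g z\<close>.\<close>

lemma continuous_on_S:
  assumes r: "continuous_on X r" and g: "continuous_on X g" and nonneg: "\<And>z. z \<in> X \<Longrightarrow> r z \<ge> 0"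
  shows "continuous_on X (\<lambda>z. S (r z) (g z))"
  unfolding continuous_on_def
proof
  fix z
  assume "z \<in> X"
  have "continuous_on X (\<lambda>y. S (r y) (g z))"
    using continuous_on_compose2[OF continuous_orbit r] nonneg by auto
  then have 1: "((\<lambda>y. S (r y) (g z) - S (r z) (g z)) \<longlongrightarrow> 0) (at z within X)"
    using \<open>z \<in> X\<close> by (simp add: continuous_on_def LIM_zero)
  have 2: "((\<lambda>y. g y - g z) \<longlongrightarrow> 0) (at z within X)"
    using g \<open>z \<in> X\<close> by (simp add: continuous_on_def LIM_zero)
  have "((\<lambda>y. S (r y) (g y) - S (r z) (g z)) \<longlongrightarrow> 0) (at z within X)"
  proof (rule Lim_null_comparison)
    have "((\<lambda>y. M * norm (g y - g z) + norm (S (r y) (g z) - S (r z) (g z)))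
        \<longlongrightarrow> M * 0 + 0) (at z within X)"
      by (intro tendsto_intros tendsto_norm_zero 1 2)
    then show "((\<lambda>y. M * norm (g y - g z) + norm (S (r y) (g z) - S (r z) (g z)))
        \<longlongrightarrow> 0) (at z within X)"
      by simp
    have "norm (S (r y) (g y) - S (r z) (g z))
        \<le> M * norm (g y - g z) + norm (S (r y) (g z) - S (r z) (g z))" if "y \<in> X" for y
      using norm_triangle_ineq[of "S (r y) (g y - g z)" "S (r y) (g z) - S (r z) (g z)"]
        norm_S_apply[of "r y" "g y - g z"] nonneg[OF that]
      by (simp add: blinfun.diff_right)
    then show "\<forall>\<^sub>F y in at z within X. norm (S (r y) (g y) - S (r z) (g z))
        \<le> M * norm (g y - g z) + norm (S (r y) (g z) - S (r z) (g z))"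
      by (simp add: eventually_at_filter)
  qed
  then show "((\<lambda>y. S (r y) (g y)) \<longlongrightarrow> S (r z) (g z)) (at z within X)"
    by (rule LIM_zero_cancel)
qed

lemma integrable_convolution:
  assumes "k integrable_on {0..T}" "(\<lambda>s. \<bar>k s\<bar>) integrable_on {0..T}"
    and "continuous_on {0..T} g" and "T \<le> t"
  shows "(\<lambda>s. k s *\<^sub>R S (t - s) (g s)) integrable_on {0..T}"
  using assms by (intro integrable_scaleR_continuous continuous_on_S continuous_intros) auto

text \<open>From \<open>t\<close> to \<open>t'\<close> the integral changes in two ways. On
  \<open>{0..t}\<close> the time argument of the semigroup moves, which has a small effect because
  \<open>S p (g s)\<close> is uniformly continuous on a compact square. The piece over
  \<open>{t..t'}\<close> is new, and small because the integral of \<open>\<bar>k s\<bar>\<close> is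
  continuous in its upper end.\<close>

lemma continuous_convolution:
  assumes k: "\<And>T. k integrable_on {0..T}" and abs_k: "\<And>T. (\<lambda>s. \<bar>k s\<bar>) integrable_on {0..T}"
    and g: "continuous_on {0..} g"
  shows "continuous_on {0..} (\<lambda>t. integral {0..t} (\<lambda>s. k s *\<^sub>R S (t - s) (g s)))"
proof (rule continuous_on_atLeastI)
  fix T :: real
  define J where "J t = integral {0..t} (\<lambda>s. k s *\<^sub>R S (t - s) (g s))" for t
  define Q where "Q = integral {0..T} (\<lambda>s. \<bar>k s\<bar>) + 1"
  have "Q > 0"
    using integral_nonneg[OF abs_k[of T]] by (simp add: Q_def)
  have gT: "continuous_on {0..T} g"
    using g by (rule continuous_on_subset) auto
  then have "bounded (g ` {0..T})"
    by (intro compact_imp_bounded compact_continuous_image) auto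
  then obtain C where "C > 0" and C: "\<And>s. s \<in> {0..T} \<Longrightarrow> norm (g s) \<le> C"
    by (auto simp: bounded_pos)
  have abs_incr: "integral {t..t'} (\<lambda>s. \<bar>k s\<bar>) = integral {0..t'} (\<lambda>s. \<bar>k s\<bar>) - integral {0..t} (\<lambda>s. \<bar>k s\<bar>)"
    if "0 \<le> t" "t \<le> t'" for t t'
    using Henstock_Kurzweil_Integration.integral_combine[OF that abs_k] by simp
  have unif_abs_k: "uniformly_continuous_on {0..T} (\<lambda>t. integral {0..t} (\<lambda>s. \<bar>k s\<bar>))"
    by (intro compact_uniformly_continuous indefinite_integral_continuous_1 abs_k) auto
  have unif_S_g: "uniformly_continuous_on ({0..T} \<times> {0..T}) (\<lambda>z. S (fst z) (g (snd z)))"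
    by (intro compact_uniformly_continuous continuous_on_S continuous_on_compose2[OF gT]
        continuous_intros compact_Times) auto
  have unif: "\<exists>d>0. \<forall>t t'. 0 \<le> t \<and> t \<le> t' \<and> t' \<le> T \<and> t' - t < d \<longrightarrow> norm (J t' - J t) < e"
    if "e > 0" for e
  proof -
    \<comment> \<open>Half of \<open>e\<close> for each effect:
      \<open>M * C * \<bar>k s\<bar>\<close> bounds the integrand of the new piece, and
      \<open>Q\<close> bounds the integral of \<open>\<bar>k s\<bar>\<close> that multiplies the
      variation of the semigroup term.\<close>
    have "e / (2 * (M * C)) > 0" "e / (2 * Q) > 0"
      using \<open>e > 0\<close> M_pos \<open>C > 0\<close> \<open>Q > 0\<close> by auto
    obtain d1 where "d1 > 0" and d1: "\<And>x y. x \<in> {0..T} \<Longrightarrow> y \<in> {0..T} \<Longrightarrow> dist y x < d1 \<Longrightarrow>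
        dist (integral {0..y} (\<lambda>s. \<bar>k s\<bar>)) (integral {0..x} (\<lambda>s. \<bar>k s\<bar>)) < e / (2 * (M * C))"
      using unif_abs_k \<open>e / (2 * (M * C)) > 0\<close> unfolding uniformly_continuous_on_def by metis
    obtain d2 where "d2 > 0"
      and d2: "\<And>x y. x \<in> {0..T} \<times> {0..T} \<Longrightarrow> y \<in> {0..T} \<times> {0..T} \<Longrightarrow> dist y x < d2 \<Longrightarrow>
        dist (S (fst y) (g (snd y))) (S (fst x) (g (snd x))) < e / (2 * Q)"
      using unif_S_g \<open>e / (2 * Q) > 0\<close> unfolding uniformly_continuous_on_def by metis
    have "norm (J t' - J t) < e"
      if t: "0 \<le> t" "t \<le> t'" "t' \<le> T" "t' - t < min d1 d2" for t t'
    proof -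
      let ?h = "\<lambda>t s. k s *\<^sub>R S (t - s) (g s)"
      have int: "?h t' integrable_on {0..t'}" "?h t' integrable_on {0..t}" "?h t integrable_on {0..t}"
        using t by (intro integrable_convolution k abs_k continuous_on_subset[OF gT]; simp)+
      have "J t' = integral {0..t} (?h t') + integral {t..t'} (?h t')"
        unfolding J_def
        using Henstock_Kurzweil_Integration.integral_combine[OF t(1,2) int(1)] by simp
      then have "J t' - J t = integral {0..t} (\<lambda>s. ?h t' s - ?h t s) + integral {t..t'} (?h t')"
        using int(2,3) by (simp add: J_def Henstock_Kurzweil_Integration.integral_diff)
      moreover have "norm (integral {0..t} (\<lambda>s. ?h t' s - ?h t s)) \<le> e / 2"
      proof -
        have "norm (integral {0..t} (\<lambda>s. ?h t' s - ?h t s)) \<le> integral {0..t} (\<lambda>s. e / (2 * Q) * \<bar>k s\<bar>)"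
        proof (rule integral_norm_bound_integral)
          fix s
          assume s: "s \<in> {0..t}"
          have "norm (S (t' - s) (g s) - S (t - s) (g s)) \<le> e / (2 * Q)"
            using d2[of "(t - s, s)" "(t' - s, s)"] s t by (auto simp: dist_Pair_Pair dist_norm)
          then have "\<bar>k s\<bar> * norm (S (t' - s) (g s) - S (t - s) (g s)) \<le> \<bar>k s\<bar> * (e / (2 * Q))"
            by (intro mult_left_mono) auto
          then show "norm (?h t' s - ?h t s) \<le> e / (2 * Q) * \<bar>k s\<bar>"
            by (simp only: scaleR_diff_right[symmetric] norm_scaleR mult.commute)
        qed (intro integrable_diff int integrable_on_mult_right abs_k)+
        also have "\<dots> = e / (2 * Q) * integral {0..t} (\<lambda>s. \<bar>k s\<bar>)"
          by simp
        also have "\<dots> \<le> e / (2 * Q) * Q"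
        proof (rule mult_left_mono)
          have "integral {0..t} (\<lambda>s. \<bar>k s\<bar>) \<le> integral {0..T} (\<lambda>s. \<bar>k s\<bar>)"
            using t by (intro integral_subset_le abs_k) auto
          then show "integral {0..t} (\<lambda>s. \<bar>k s\<bar>) \<le> Q"
            by (simp add: Q_def)
        qed (use \<open>e / (2 * Q) > 0\<close> in simp)
        finally show ?thesis
          using \<open>Q > 0\<close> by simp
      qed
      moreover have "norm (integral {t..t'} (?h t')) < e / 2"
      proof -
        have "norm (integral {t..t'} (?h t')) \<le> integral {t..t'} (\<lambda>s. M * C * \<bar>k s\<bar>)"
        proof (rule integral_norm_bound_integral)
          show "?h t' integrable_on {t..t'}"
            using int(1) by (rule integrable_subinterval_real) (use t in auto)
          show "(\<lambda>s. M * C * \<bar>k s\<bar>) integrable_on {t..t'}"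
            using integrable_subinterval_real[OF abs_k[of t'], of t t'] t
            by (intro integrable_on_mult_right) auto
          fix s
          assume s: "s \<in> {t..t'}"
          have "norm (S (t' - s) (g s)) \<le> M * norm (g s)"
            using s by (intro norm_S_apply) auto
          also have "\<dots> \<le> M * C"
            using C[of s] s t M_pos by (intro mult_left_mono) auto
          finally have "\<bar>k s\<bar> * norm (S (t' - s) (g s)) \<le> \<bar>k s\<bar> * (M * C)"
            by (rule mult_left_mono) simp
          then show "norm (?h t' s) \<le> M * C * \<bar>k s\<bar>"
            by (simp add: mult.commute)
        qed
        also have "\<dots> = M * C * integral {t..t'} (\<lambda>s. \<bar>k s\<bar>)"
          by simp
        also have "\<dots> < M * C * (e / (2 * (M * C)))"
          using d1[of t t'] t abs_incr[of t t'] M_pos \<open>C > 0\<close>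
          by (intro mult_strict_left_mono) (auto simp: dist_real_def)
        finally show ?thesis
          using M_pos \<open>C > 0\<close> by simp
      qed
      ultimately have "norm (J t' - J t) < e / 2 + e / 2"
        by (simp only: norm_triangle_lt add_le_less_mono)
      then show ?thesis
        by simp
    qed
    then show ?thesis
      using \<open>d1 > 0\<close> \<open>d2 > 0\<close> by (intro exI[of _ "min d1 d2"]) auto
  qed
  have "continuous_on {0..T} J"
    unfolding continuous_on_iff
  proof (intro ballI allI impI)
    fix x e :: real
    assume "x \<in> {0..T}" "e > 0"
    obtain d where "d > 0" and d: "\<And>t t'. 0 \<le> t \<Longrightarrow> t \<le> t' \<Longrightarrow> t' \<le> T \<Longrightarrow> t' - t < d \<Longrightarrow>
        norm (J t' - J t) < e"
      using unif[OF \<open>e > 0\<close>] by metis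
    have "dist (J y) (J x) < e" if "y \<in> {0..T}" "dist y x < d" for y
      using d[of x y] d[of y x] that \<open>x \<in> {0..T}\<close>
      by (cases "x \<le> y") (auto simp: dist_norm norm_minus_commute)
    then show "\<exists>d>0. \<forall>y\<in>{0..T}. dist y x < d \<longrightarrow> dist (J y) (J x) < e"
      using \<open>d > 0\<close> by blast
  qed
  then show "continuous_on {0..T} (\<lambda>t. integral {0..t} (\<lambda>s. k s *\<^sub>R S (t - s) (g s)))"
    by (simp add: J_def)
qed

end

section \<open>The Duhamel operator and its contraction estimate\<close>

locale delay_equation = bounded_semigroup S M
  for S :: "real \<Rightarrow> 'a::banach \<Rightarrow>\<^sub>L 'a" and M :: real +
  fixes B :: "'a \<Rightarrow>\<^sub>L 'a" and G :: "'a \<Rightarrow> 'a" and k \<tau> :: "real \<Rightarrow> real" and f :: "real \<Rightarrow> 'a"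
    and \<tau>\<^sub>m L :: real
  assumes \<tau>\<^sub>m_nonneg: "\<tau>\<^sub>m \<ge> 0"
    and \<tau>_cont: "continuous_on {0..} \<tau>"
    and \<tau>_bounds: "t \<ge> 0 \<Longrightarrow> 0 \<le> \<tau> t \<and> \<tau> t \<le> \<tau>\<^sub>m"
    and k_int: "k integrable_on {0..T}"
    and abs_k_int: "(\<lambda>s. \<bar>k s\<bar>) integrable_on {0..T}"
    and G_0: "G 0 = 0"
    and L_nonneg: "L \<ge> 0"
    and G_lipschitz: "norm (G x - G y) \<le> L * norm (x - y)"
    and f_cont: "continuous_on {-\<tau>\<^sub>m..0} f"
begin

definition forcing :: "(real \<Rightarrow> 'a) \<Rightarrow> real \<Rightarrow> 'a" where
  "forcing U s = G (U s) + k s *\<^sub>R B (U (s - \<tau> s))"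

definition duhamel :: "(real \<Rightarrow> 'a) \<Rightarrow> real \<Rightarrow> 'a" where
  "duhamel U t = S t (f 0) + integral {0..t} (\<lambda>s. S (t - s) (forcing U s))"

text \<open>The Lipschitz constant of the Duhamel integrand at time \<open>s\<close>:
  \<open>L\<close> from \<open>G\<close> and \<open>norm B * \<bar>k s\<bar>\<close> from the
  delayed term, multiplied by the semigroup bound.\<close>

definition rate :: "real \<Rightarrow> real" where
  "rate s = M * (L + norm B * \<bar>k s\<bar>)"

text \<open>For \<open>t < 0\<close> the integral runs over an empty interval, so the weight is 1 on
  the history interval. The factor 2 brings the constant of the contraction below 1.\<close>

definition weight :: "real \<Rightarrow> real" where
  "weight t = exp (2 * integral {0..t} rate)"

lemma rate_integrable: "rate integrable_on {0..T}"
proof -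
  have "(\<lambda>s. M * (L + norm B * \<bar>k s\<bar>)) integrable_on {0..T}"
    by (intro integrable_on_mult_right integrable_add abs_k_int integrable_const_ivl)
  then show ?thesis
    by (simp add: rate_def[abs_def])
qed

lemma rate_nonneg: "rate s \<ge> 0"
  using M_pos L_nonneg by (simp add: rate_def)

lemma weight_nonpos: "t \<le> 0 \<Longrightarrow> weight t = 1"
  by (cases "t = 0") (auto simp: weight_def)

lemma weight_pos: "weight t > 0"
  by (simp add: weight_def)

lemma weight_ge_1: "weight t \<ge> 1"
  using integral_nonneg[OF rate_integrable, of t] rate_nonneg by (simp add: weight_def)

lemma weight_mono: "s \<le> t \<Longrightarrow> weight s \<le> weight t"
  using integral_subset_le[OF _ rate_integrable rate_integrable, of s t] rate_nonneg
  by (simp add: weight_def)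

lemma weight_continuous: "continuous_on X weight"
proof -
  have "continuous_on {0..} (\<lambda>t. integral {0..t} rate)"
    by (intro continuous_on_atLeastI indefinite_integral_continuous_1 rate_integrable)
  then have "continuous_on {0..} weight"
    unfolding weight_def[abs_def] by (intro continuous_intros)
  \<comment> \<open>Continuity passes from the half-line to the whole line because clamping the
    argument at 0 leaves the weight unchanged.\<close>
  then have "continuous_on UNIV (\<lambda>t. weight (max 0 t))"
    by (rule continuous_on_compose2) (auto intro!: continuous_intros)
  moreover have "weight (max 0 t) = weight t" for t
    by (cases "t \<le> 0") (simp_all add: weight_nonpos)
  ultimately have "continuous_on UNIV weight"
    by simp
  then show ?thesis
    by (rule continuous_on_subset) simp
qed

lemma continuous_on_G:
  assumes "continuous_on X U"
  shows "continuous_on X (\<lambda>s. G (U s))"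
proof -
  have "L-lipschitz_on UNIV G"
    by (rule lipschitz_onI) (simp_all add: dist_norm G_lipschitz L_nonneg)
  then show ?thesis
    using continuous_on_compose2[OF lipschitz_on_continuous_on assms] by blast
qed

lemma continuous_on_delayed:
  assumes "continuous_on {-\<tau>\<^sub>m..} U"
  shows "continuous_on {0..} (\<lambda>s. B (U (s - \<tau> s)))"
  using \<tau>_bounds \<tau>_cont
  by (intro continuous_intros continuous_on_compose2[OF assms]) fastforce+

text \<open>Written with the kernel \<open>1\<close>, the \<open>G\<close> term has the same form as
  the delayed term with kernel \<open>k\<close>, so \<open>integrable_convolution\<close> and
  \<open>continuous_convolution\<close> apply to both summands.\<close>

lemma duhamel_integrand:
  "S (t - s) (forcing U s) = 1 *\<^sub>R S (t - s) (G (U s)) + k s *\<^sub>R S (t - s) (B (U (s - \<tau> s)))"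
  by (simp add: forcing_def blinfun.add_right blinfun.scaleR_right)

context
  fixes U :: "real \<Rightarrow> 'a"
  assumes U: "continuous_on {-\<tau>\<^sub>m..} U"
begin

lemma duhamel_G_continuous: "continuous_on {0..} (\<lambda>s. G (U s))"
  using continuous_on_G[OF U] by (rule continuous_on_subset) (use \<tau>\<^sub>m_nonneg in auto)

lemma duhamel_terms_integrable:
  "(\<lambda>s. 1 *\<^sub>R S (t - s) (G (U s))) integrable_on {0..t}"
  "(\<lambda>s. k s *\<^sub>R S (t - s) (B (U (s - \<tau> s)))) integrable_on {0..t}"
proof -
  show "(\<lambda>s. 1 *\<^sub>R S (t - s) (G (U s))) integrable_on {0..t}"
    by (rule integrable_convolution)
      (auto intro: continuous_on_subset[OF duhamel_G_continuous])
  show "(\<lambda>s. k s *\<^sub>R S (t - s) (B (U (s - \<tau> s)))) integrable_on {0..t}"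
    by (rule integrable_convolution)
      (auto intro: k_int abs_k_int continuous_on_subset[OF continuous_on_delayed[OF U]])
qed

lemma duhamel_integrable: "(\<lambda>s. S (t - s) (forcing U s)) integrable_on {0..t}"
  unfolding duhamel_integrand by (intro integrable_add duhamel_terms_integrable)

lemma duhamel_continuous: "continuous_on {0..} (duhamel U)"
proof -
  have "duhamel U = (\<lambda>t. S t (f 0) + (integral {0..t} (\<lambda>s. 1 *\<^sub>R S (t - s) (G (U s)))
      + integral {0..t} (\<lambda>s. k s *\<^sub>R S (t - s) (B (U (s - \<tau> s))))))"
    unfolding duhamel_def[abs_def] duhamel_integrand
    by (simp only: Henstock_Kurzweil_Integration.integral_add[OF duhamel_terms_integrable])
  moreover have "continuous_on {0..} \<dots>"
    by (intro continuous_on_add continuous_orbit continuous_convolution k_int abs_k_int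
        integrable_const_ivl duhamel_G_continuous continuous_on_delayed[OF U])
  ultimately show ?thesis
    by simp
qed

end

text \<open>The integrands differ by at most \<open>N * (rate s * weight s)\<close>, whose integral
  is controlled by the weight itself. Only times up to \<open>t\<close> enter the bound
  \<open>N\<close>, so it may be a global distance, as for existence, or a maximum over a compact
  interval, as for uniqueness.\<close>

lemma duhamel_diff_le:
  assumes U: "continuous_on {-\<tau>\<^sub>m..} U" and V: "continuous_on {-\<tau>\<^sub>m..} V" and "t \<ge> 0"
    and UV: "\<And>s. s \<in> {-\<tau>\<^sub>m..t} \<Longrightarrow> norm (U s - V s) \<le> N * weight s"
  shows "norm (duhamel U t - duhamel V t) \<le> 3 / 4 * N * weight t"
proof -
  have "norm (U t - V t) \<le> N * weight t"
    using UV \<tau>\<^sub>m_nonneg \<open>t \<ge> 0\<close> by simp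
  then have "0 \<le> N * weight t"
    using norm_ge_zero order_trans by blast
  then have "N \<ge> 0"
    using weight_pos[of t] by (simp add: zero_le_mult_iff)
  have weight_int: "(\<lambda>s. rate s * weight s) integrable_on {0..t}"
    using integrable_scaleR_continuous[OF rate_integrable _ weight_continuous, of t]
      rate_integrable rate_nonneg by simp
  have "norm (duhamel U t - duhamel V t)
      = norm (integral {0..t} (\<lambda>s. S (t - s) (forcing U s) - S (t - s) (forcing V s)))"
    using Henstock_Kurzweil_Integration.integral_diff[OF duhamel_integrable[OF U]
        duhamel_integrable[OF V]]
    by (simp add: duhamel_def)
  also have "\<dots> \<le> integral {0..t} (\<lambda>s. N * (rate s * weight s))"
  proof (rule integral_norm_bound_integral)
    fix s
    assume s: "s \<in> {0..t}"
    have "s - \<tau> s \<in> {-\<tau>\<^sub>m..t}" "s - \<tau> s \<le> s"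
      using s \<tau>_bounds[of s] by auto
    have "norm (G (U s) - G (V s)) \<le> L * (N * weight s)"
      using G_lipschitz[of "U s" "V s"] mult_left_mono[OF UV[of s] L_nonneg] s \<tau>\<^sub>m_nonneg by auto
    moreover have "norm (k s *\<^sub>R B (U (s - \<tau> s) - V (s - \<tau> s))) \<le> \<bar>k s\<bar> * (norm B * (N * weight s))"
    proof -
      have "norm (U (s - \<tau> s) - V (s - \<tau> s)) \<le> N * weight (s - \<tau> s)"
        using UV \<open>s - \<tau> s \<in> {-\<tau>\<^sub>m..t}\<close> by blast
      also have "\<dots> \<le> N * weight s"
        using weight_mono[OF \<open>s - \<tau> s \<le> s\<close>] \<open>N \<ge> 0\<close> by (rule mult_left_mono)
      finally have "norm B * norm (U (s - \<tau> s) - V (s - \<tau> s)) \<le> norm B * (N * weight s)"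
        by (rule mult_left_mono) simp
      then have "norm (B (U (s - \<tau> s) - V (s - \<tau> s))) \<le> norm B * (N * weight s)"
        using norm_blinfun order_trans by blast
      then show ?thesis
        by (simp add: mult_left_mono)
    qed
    moreover have "forcing U s - forcing V s
        = (G (U s) - G (V s)) + k s *\<^sub>R B (U (s - \<tau> s) - V (s - \<tau> s))"
      by (simp add: forcing_def blinfun.diff_right scaleR_diff_right)
    ultimately have "norm (forcing U s - forcing V s)
        \<le> L * (N * weight s) + \<bar>k s\<bar> * (norm B * (N * weight s))"
      by (metis norm_triangle_mono)
    then have "M * norm (forcing U s - forcing V s)
        \<le> M * (L * (N * weight s) + \<bar>k s\<bar> * (norm B * (N * weight s)))"
      using M_pos by (intro mult_left_mono) auto
    also have "\<dots> = N * (rate s * weight s)"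
      by (simp add: rate_def algebra_simps)
    finally show "norm (S (t - s) (forcing U s) - S (t - s) (forcing V s)) \<le> N * (rate s * weight s)"
      using norm_S_apply[of "t - s" "forcing U s - forcing V s"] s by (simp add: blinfun.diff_right)
  qed (intro integrable_diff duhamel_integrable U V integrable_on_mult_right weight_int)+
  also have "\<dots> = N * integral {0..t} (\<lambda>s. rate s * weight s)"
    by simp
  \<comment> \<open>The estimate is used with \<open>m = rate\<close> and \<open>a\<close> its
    integral from 0, so that \<open>exp (2 * a s)\<close> is \<open>weight s\<close>.\<close>
  also have "\<dots> \<le> N * (3 / 4 * weight t)"
    using integral_mult_exp_primitive_le[OF rate_integrable rate_nonneg refl \<open>t \<ge> 0\<close>] \<open>N \<ge> 0\<close>
    unfolding weight_def by (rule mult_left_mono)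
  finally show ?thesis
    by (simp add: mult_ac)
qed

section \<open>Uniqueness and existence of weak solutions\<close>

text \<open>The integrability clause is supplied by \<open>duhamel_integrable\<close>, which turns
  the problem into a fixed point equation for \<open>duhamel\<close> with prescribed
  history.\<close>

lemma weak_solution_iff:
  "weak_solution S B G k \<tau> \<tau>\<^sub>m f U \<longleftrightarrow>
    continuous_on {-\<tau>\<^sub>m..} U \<and> (\<forall>t\<in>{-\<tau>\<^sub>m..0}. U t = f t) \<and> (\<forall>t\<ge>0. U t = duhamel U t)"
  using duhamel_integrable[of U] unfolding weak_solution_def duhamel_def forcing_def by blast

lemma weak_solution_unique:
  assumes "weak_solution S B G k \<tau> \<tau>\<^sub>m f U" "weak_solution S B G k \<tau> \<tau>\<^sub>m f V" and "t \<ge> -\<tau>\<^sub>m"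
  shows "U t = V t"
proof -
  have cont: "continuous_on {-\<tau>\<^sub>m..} U" "continuous_on {-\<tau>\<^sub>m..} V"
    and init: "\<And>s. s \<in> {-\<tau>\<^sub>m..0} \<Longrightarrow> U s = V s"
    and eq: "\<And>s. s \<ge> 0 \<Longrightarrow> U s = duhamel U s" "\<And>s. s \<ge> 0 \<Longrightarrow> V s = duhamel V s"
    using assms unfolding weak_solution_iff by auto
  define q where "q s = norm (U s - V s) / weight s" for s
  have "continuous_on {-\<tau>\<^sub>m..t} q"
    unfolding q_def using weight_pos
    by (intro continuous_intros weight_continuous continuous_on_subset[OF cont(1)]
        continuous_on_subset[OF cont(2)]) (auto simp: less_imp_neq[symmetric])
  then obtain x where x: "x \<in> {-\<tau>\<^sub>m..t}" and max: "\<And>s. s \<in> {-\<tau>\<^sub>m..t} \<Longrightarrow> q s \<le> q x"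
    using continuous_attains_sup[of "{-\<tau>\<^sub>m..t}" q] \<open>t \<ge> -\<tau>\<^sub>m\<close> by auto
  have "q x \<le> 0"
  proof (cases "x \<le> 0")
    case True
    then show ?thesis
      using init[of x] x by (simp add: q_def)
  next
    case False
    \<comment> \<open>Maximality of \<open>q x\<close> makes it an admissible \<open>N\<close> up to
      time \<open>x\<close>; the contraction then gives
      \<open>q x \<le> 3 / 4 * q x\<close>.\<close>
    have "norm (U s - V s) \<le> q x * weight s" if "s \<in> {-\<tau>\<^sub>m..x}" for s
      using max[of s] that x weight_pos[of s] by (simp add: q_def pos_divide_le_eq)
    then have "norm (duhamel U x - duhamel V x) \<le> 3 / 4 * q x * weight x"
      using False by (intro duhamel_diff_le cont) auto
    then have "q x \<le> 3 / 4 * q x"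
      using eq[of x] False weight_pos[of x] unfolding q_def by (simp add: pos_divide_le_eq)
    then show ?thesis
      by simp
  qed
  then have "norm (U t - V t) / weight t \<le> 0"
    using max[of t] \<open>t \<ge> -\<tau>\<^sub>m\<close> by (simp add: q_def)
  then show ?thesis
    using weight_pos[of t] by (simp add: divide_le_0_iff)
qed

lemma weak_solution_exists: "\<exists>U. weak_solution S B G k \<tau> \<tau>\<^sub>m f U"
proof -
  \<comment> \<open>\<open>w\<close> stands for \<open>U / weight\<close>, which is bounded although
    \<open>U\<close> may grow; \<open>lift\<close> recovers \<open>U\<close>.\<close>
  define lift where "lift w s = weight s *\<^sub>R apply_bcontfun w s" for w :: "real \<Rightarrow>\<^sub>C 'a" and s
  \<comment> \<open>The clamps extend the map to functions on the whole line. For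
    \<open>t \<ge> 0\<close> the difference of the two values of \<open>f\<close> vanishes. For
    \<open>t \<le> 0\<close> the first summand is \<open>f 0\<close>, so the sum is
    \<open>f t\<close> on the history interval and constant before it.\<close>
  define \<Psi> where "\<Psi> w t = (1 / weight (max 0 t)) *\<^sub>R duhamel (lift w) (max 0 t)
    + (f (max (-\<tau>\<^sub>m) (min 0 t)) - f 0)" for w t
  have lift_cont: "continuous_on X (lift w)" for X w
    unfolding lift_def[abs_def] by (intro continuous_intros weight_continuous) auto
  have lift_diff: "norm (duhamel (lift w) t - duhamel (lift v) t) \<le> 3 / 4 * dist w v * weight t"
    if "t \<ge> 0" for w v t
  proof (rule duhamel_diff_le[OF lift_cont lift_cont that])
    fix s
    have "norm (lift w s - lift v s) = weight s * dist (w s) (v s)"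
      using weight_pos[of s] by (simp add: lift_def scaleR_diff_right[symmetric] dist_norm)
    also have "\<dots> \<le> weight s * dist w v"
      using weight_pos[of s] by (intro mult_left_mono dist_bounded) auto
    finally show "norm (lift w s - lift v s) \<le> dist w v * weight s"
      by (simp add: mult.commute)
  qed
  have "\<Psi> w \<in> bcontfun" for w
  proof -
    have "bounded (f ` {-\<tau>\<^sub>m..0})"
      by (intro compact_imp_bounded compact_continuous_image f_cont) auto
    then obtain C where C: "\<And>s. s \<in> {-\<tau>\<^sub>m..0} \<Longrightarrow> norm (f s) \<le> C"
      unfolding bounded_iff by blast
    show ?thesis
    proof (rule bcontfun_normI)
      have "continuous_on UNIV (\<lambda>t::real. duhamel (lift w) (max 0 t))"
        by (rule continuous_on_compose2[OF duhamel_continuous[OF lift_cont]])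
          (auto intro!: continuous_intros)
      moreover have "continuous_on UNIV (\<lambda>t. f (max (-\<tau>\<^sub>m) (min 0 t)))"
        by (rule continuous_on_compose2[OF f_cont])
          (use \<tau>\<^sub>m_nonneg in \<open>auto intro!: continuous_intros\<close>)
      moreover have "continuous_on UNIV (\<lambda>t::real. weight (max 0 t))"
        by (rule continuous_on_compose2[OF weight_continuous[of UNIV]])
          (auto intro!: continuous_intros)
      ultimately show "continuous_on UNIV (\<Psi> w)"
        unfolding \<Psi>_def using weight_pos
        by (intro continuous_intros) (auto simp: less_imp_neq[symmetric])
      fix t :: real
      define p where "p = max 0 t"
      have "p \<ge> 0"
        by (simp add: p_def)
      \<comment> \<open>The image of 0 is the free orbit, by \<open>G_0\<close>. Being bounded, it
        is the reference from which \<open>lift_diff\<close> bounds every other image in the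
        weighted norm.\<close>
      have "duhamel (lift 0) p = S p (f 0)"
        by (simp add: duhamel_def forcing_def lift_def G_0)
      then have "norm (duhamel (lift w) p) \<le> 3 / 4 * norm w * weight p + M * norm (f 0)"
        using lift_diff[OF \<open>p \<ge> 0\<close>, of w 0] norm_S_apply[OF \<open>p \<ge> 0\<close>, of "f 0"]
          norm_triangle_sub[of "duhamel (lift w) p" "S p (f 0)"]
        by simp
      also have "\<dots> \<le> (3 / 4 * norm w + M * norm (f 0)) * weight p"
        using mult_left_mono[OF weight_ge_1[of p], of "M * norm (f 0)"] M_pos
        by (simp add: algebra_simps)
      finally have "norm ((1 / weight p) *\<^sub>R duhamel (lift w) p) \<le> 3 / 4 * norm w + M * norm (f 0)"
        using weight_pos[of p] by (simp add: pos_divide_le_eq)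
      moreover have "norm (f (max (-\<tau>\<^sub>m) (min 0 t)) - f 0) \<le> C + norm (f 0)"
        using C[of "max (-\<tau>\<^sub>m) (min 0 t)"] \<tau>\<^sub>m_nonneg
          norm_triangle_ineq4[of "f (max (-\<tau>\<^sub>m) (min 0 t))" "f 0"] by auto
      ultimately show "norm (\<Psi> w t) \<le> (3 / 4 * norm w + M * norm (f 0)) + (C + norm (f 0))"
        unfolding \<Psi>_def p_def[symmetric] by (rule norm_triangle_mono)
    qed
  qed
  then have apply_\<Psi>: "apply_bcontfun (Bcontfun (\<Psi> w)) = \<Psi> w" for w
    by (rule Bcontfun_inverse)
  have "dist (Bcontfun (\<Psi> w)) (Bcontfun (\<Psi> v)) \<le> 3 / 4 * dist w v" for w v
  proof (rule dist_bound)
    fix t :: real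
    \<comment> \<open>The terms with \<open>f\<close> are the same for \<open>w\<close> and
      \<open>v\<close> and cancel; only the weighted Duhamel difference remains.\<close>
    have "dist (\<Psi> w t) (\<Psi> v t)
        = norm (duhamel (lift w) (max 0 t) - duhamel (lift v) (max 0 t)) / weight (max 0 t)"
      using weight_pos[of "max 0 t"]
      by (simp add: \<Psi>_def dist_norm scaleR_diff_right[symmetric])
    also have "\<dots> \<le> 3 / 4 * dist w v"
      using lift_diff[of "max 0 t" w v] weight_pos[of "max 0 t"] by (simp add: pos_divide_le_eq)
    finally show "dist (Bcontfun (\<Psi> w) t) (Bcontfun (\<Psi> v) t) \<le> 3 / 4 * dist w v"
      by (simp add: apply_\<Psi>)
  qed
  then have "\<exists>!w. Bcontfun (\<Psi> w) = w"
    by (intro banach_fix_type[of "3 / 4"]) auto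
  then obtain w where "Bcontfun (\<Psi> w) = w"
    by blast
  then have fixed: "w t = \<Psi> w t" for t
    using apply_\<Psi>[of w] by simp
  \<comment> \<open>This value cancels the \<open>- f 0\<close> in \<open>\<Psi>\<close>, so on the
    history interval, where the weight is 1, the fixed point equation reads
    \<open>w t = f t\<close>.\<close>
  have "duhamel (lift w) 0 = f 0"
    using C0 by (simp add: duhamel_def C0_semigroup_def)
  then have "lift w t = f t" if "t \<in> {-\<tau>\<^sub>m..0}" for t
    using that fixed[of t] by (simp add: lift_def weight_nonpos \<Psi>_def)
  moreover have "lift w t = duhamel (lift w) t" if "t \<ge> 0" for t
    using that fixed[of t] weight_pos[of t] \<tau>\<^sub>m_nonneg by (simp add: lift_def \<Psi>_def)
  ultimately have "weak_solution S B G k \<tau> \<tau>\<^sub>m f (lift w)"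
    unfolding weak_solution_iff using lift_cont by blast
  then show ?thesis
    by blast
qed

end

section \<open>Well-posedness for an exponentially stable semigroup on a Hilbert space\<close>

theorem theorem4p1:
  fixes S :: "real \<Rightarrow> 'a::{real_inner, banach} \<Rightarrow>\<^sub>L 'a"
    and D :: "'a set" and A :: "'a \<Rightarrow> 'a"
    and B :: "'a \<Rightarrow>\<^sub>L 'a" and G :: "'a \<Rightarrow> 'a"
    and k \<tau> :: "real \<Rightarrow> real" and f :: "real \<Rightarrow> 'a"
    and M \<omega> \<tau>\<^sub>m K L :: real
  assumes "C0_semigroup S"
    and "generator_of S D A"
    and "M > 0" and "\<omega> > 0"
    and "\<And>t. t \<ge> 0 \<Longrightarrow> norm (S t) \<le> M * exp (- \<omega> * t)"
    and "\<tau>\<^sub>m > 0"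
    and "continuous_on {0..} \<tau>"
    and "\<And>t. t \<ge> 0 \<Longrightarrow> 0 < \<tau> t \<and> \<tau> t \<le> \<tau>\<^sub>m"
    and "L1_loc {-\<tau>\<^sub>m..} k"
    and "K > 0"
    and "\<And>t. t \<ge> 0 \<Longrightarrow> integral {t - \<tau>\<^sub>m..t} (\<lambda>s. \<bar>k s\<bar>) \<le> K"
    and "G 0 = 0"
    and "L > 0"
    and "\<And>U1 U2. norm (G U1 - G U2) \<le> L * norm (U1 - U2)"
    and "continuous_on {-\<tau>\<^sub>m..0} f"
  shows "\<exists>U. weak_solution S B G k \<tau> \<tau>\<^sub>m f U \<and>
           (\<forall>V. weak_solution S B G k \<tau> \<tau>\<^sub>m f V \<longrightarrow> (\<forall>t\<in>{-\<tau>\<^sub>m..}. V t = U t))"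
  proof -
  have k_abs: "k absolutely_integrable_on {0..T}" for T
  proof -
    have "{0..T} \<subseteq> {-\<tau>\<^sub>m..}"
      using assms(6) by auto
    then show ?thesis
      using assms(9) unfolding L1_loc_def by (meson compact_Icc)
  qed
  interpret delay_equation S M B G k \<tau> f \<tau>\<^sub>m L
  proof
    show "C0_semigroup S" "M > 0" "continuous_on {0..} \<tau>" "G 0 = 0"
      "continuous_on {-\<tau>\<^sub>m..0} f" "\<tau>\<^sub>m \<ge> 0" "L \<ge> 0"
      using assms by auto
    show "norm (S t) \<le> M" if "t \<ge> 0" for t
    proof -
      \<comment> \<open>The decaying exponential is at most 1 for \<open>t \<ge> 0\<close>, which
        gives the uniform bound required by \<open>bounded_semigroup\<close>.\<close>
      have "M * exp (- \<omega> * t) \<le> M * 1"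
        using assms(3,4) that by (intro mult_left_mono) auto
      then show ?thesis
        using assms(5)[OF that] by linarith
    qed
    show "0 \<le> \<tau> t \<and> \<tau> t \<le> \<tau>\<^sub>m" if "t \<ge> 0" for t
      using assms(8)[OF that] by auto
    show "k integrable_on {0..T}" "(\<lambda>s. \<bar>k s\<bar>) integrable_on {0..T}" for T
      using k_abs[of T] by (auto simp: absolutely_integrable_on_def)
    show "norm (G x - G y) \<le> L * norm (x - y)" for x y
      by (rule assms(14))
  qed
  show ?thesis
    using weak_solution_exists weak_solution_unique by (metis atLeast_iff)
qed

end
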